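(* For any undirected graphs $G$, $H$ and $J$ and any height-two poset $\vec P$, $$\mathrm{im}((G\vee H)\times J)\le \mathrm{im}(G\times J)+\mathrm{im}(H\times J),$$ $$\mathrm{sim}((G\vee H)\times J)\le \mathrm{sim}(G\times J)+\mathrm{sim}(H\times J),$$ $$\dim((G\cdot H)\times_e \vec P)\le \dim(G\times_e \vec P)+\chi(G)\,\dim(H\times_e \vec P)+\dim(\vec P),$$ where $\chi(G)$ is the chromatic number of $G$.
   Context: Graphs are finite and simple. For each product below the vertex set is $V(G)\times V(H)$. The edge sets are: tensor product: $E(G\times H)=\{(u,a)(v,b): uv\in E(G)\text{ and }ab\in E(H)\}$; extended tensor product: $E(G\times_e H)=\{(u,a)(v,b): (uv\in E(G)\text{ or }u=v)\text{ and }ab\in E(H)\}$; disjunctive product: $E(G\vee H)=\{(u,a)(v,b): uv\in E(G)\text{ or }ab\in E(H)\}$; lexicographic product: $E(G\cdot H)=\{(u,a)(v,b): uv\in E(G)\text{ or }(u=v\text{ and }ab\in E(H))\}$. If $G$ is undirected and $\vec P$ is directed, $G\times_e\vec P$ is the directed graph with an arc from $(u,a)$ to $(v,b)$ iff ($uv\in E(G)$ or $u=v$) and there is an arc from $a$ to $b$ in $\vec P$. Induced matching: a matching $\mathcal M\subseteq E(G)$ such that for any two distinct edges $uu',vv'\in\mathcal M$, $G$ has none of the edges $uv,uv',u'v,u'v'$. $\mathrm{im}(G)$ is the maximum cardinality of an induced matching of $G$. Semi-induced matching: for a total order $\sigma$ on $V(G)$ (a bijection $V(G)\to\{1,\dots,|V(G)|\}$),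 a matching $\mathcal M$ is $\sigma$-semi-induced if for any pair of edges $uu',vv'\in\mathcal M$ with $\sigma(u)<\sigma(u')$ and $\sigma(u)<\sigma(v)<\sigma(v')$, neither $uv$ nor $uv'$ is an edge of $G$. $\mathrm{sim}_\sigma(G)$ is the maximum size of a $\sigma$-semi-induced matching, and $\mathrm{sim}(G)=\max_\sigma \mathrm{sim}_\sigma(G)$. Poset: a directed graph $\vec P$ that is acyclic and transitive ($uv,vw\in E(\vec P)\Rightarrow uw\in E(\vec P)$). A vertex is minimal (maximal) if it has in-degree (out-degree) zero. $\vec P$ is height-two if every vertex is minimal or maximal (possibly both). (If $\vec P$ is a height-two poset and $G$ is an undirected graph, then $G\times_e\vec P$ is a poset, so its dimension is defined.) Poset dimension: for $p,q\in\mathbb R^d$ write $p<q$ if $p[i]\le q[i]$ for all $i$ and $p[j]<q[j]$ for some $j$. A map $\varphi:V(\vec P)\to\mathbb R^d$ realizes $\vec P$ if for all distinct $u,v\in V(\vec P)$, $uv\in E(\vec P)$ iff $\varphi(u)<\varphi(v)$. $\dim(\vec P)$ is the smallest integer $d$ for which a map $V(\vec P)\to\mathbb R^d$ realizing $\vec P$ exists. *)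

theory Defs
  imports Complex_Main "Graph_Theory.Graph_Theory"
begin

text \<open>
  A finite simple undirected graph is a \<^locale>\<open>pair_graph\<close>, that is, a finite loop-free digraph
  without parallel arcs whose arc relation is symmetric: the edge \<open>uv\<close> is represented by the two
  arcs \<open>(u, v)\<close> and \<open>(v, u)\<close>.  Wherever edges are counted, the unordered edges below are used.
\<close>

definition edges :: "'a pair_pre_digraph \<Rightarrow> 'a set set" where
  "edges G = {{u, v} | u v. (u, v) \<in> parcs G}"


section \<open>Graph products\<close>

definition tensor_prod ::
  "'a pair_pre_digraph \<Rightarrow> 'b pair_pre_digraph \<Rightarrow> ('a \<times> 'b) pair_pre_digraph" where
  "tensor_prod G H =
    \<lparr> pverts = pverts G \<times> pverts H,
      parcs = {((u, a), (v, b)) | u a v b. (u, v) \<in> parcs G \<and> (a, b) \<in> parcs H} \<rparr>"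

text \<open>The second factor may be a directed graph.\<close>

definition ext_tensor_prod ::
  "'a pair_pre_digraph \<Rightarrow> 'b pair_pre_digraph \<Rightarrow> ('a \<times> 'b) pair_pre_digraph" where
  "ext_tensor_prod G P =
    \<lparr> pverts = pverts G \<times> pverts P,
      parcs = {((u, a), (v, b)) | u a v b.
        u \<in> pverts G \<and> v \<in> pverts G \<and> ((u, v) \<in> parcs G \<or> u = v) \<and> (a, b) \<in> parcs P} \<rparr>"

definition disj_prod ::
  "'a pair_pre_digraph \<Rightarrow> 'b pair_pre_digraph \<Rightarrow> ('a \<times> 'b) pair_pre_digraph" where
  "disj_prod G H =
    \<lparr> pverts = pverts G \<times> pverts H,
      parcs = {((u, a), (v, b)) | u a v b.
        u \<in> pverts G \<and> v \<in> pverts G \<and> a \<in> pverts H \<and> b \<in> pverts H \<and>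
        ((u, v) \<in> parcs G \<or> (a, b) \<in> parcs H)} \<rparr>"

definition lexicographic_prod ::
  "'a pair_pre_digraph \<Rightarrow> 'b pair_pre_digraph \<Rightarrow> ('a \<times> 'b) pair_pre_digraph" where
  "lexicographic_prod G H =
    \<lparr> pverts = pverts G \<times> pverts H,
      parcs = {((u, a), (v, b)) | u a v b.
        u \<in> pverts G \<and> v \<in> pverts G \<and> a \<in> pverts H \<and> b \<in> pverts H \<and>
        ((u, v) \<in> parcs G \<or> (u = v \<and> (a, b) \<in> parcs H))} \<rparr>"

lemma pair_graph_intro:
  assumes "finite (pverts G)" and "parcs G \<subseteq> pverts G \<times> pverts G"
    and "sym (parcs G)" and "irrefl (parcs G)"
  shows "pair_graph G"
proof -
  have "finite (parcs G)"
    using assms(1,2) by (meson finite_SigmaI finite_subset)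
  then show ?thesis
    using assms by unfold_locales (auto simp: symmetric_def irrefl_def)
qed

lemma pair_graph_facts:
  assumes "pair_graph G"
  shows "finite (pverts G)" and "(u, v) \<in> parcs G \<Longrightarrow> u \<in> pverts G \<and> v \<in> pverts G"
    and "(u, v) \<in> parcs G \<Longrightarrow> (v, u) \<in> parcs G" and "(u, u) \<notin> parcs G"
proof -
  interpret pair_graph G by fact
  show "finite (pverts G)" by (rule pair_finite_verts)
  show "(u, v) \<in> parcs G \<Longrightarrow> u \<in> pverts G \<and> v \<in> pverts G" by (blast dest: wellformed')
  show "(u, v) \<in> parcs G \<Longrightarrow> (v, u) \<in> parcs G" by (rule arcs_symmetric)
  show "(u, u) \<notin> parcs G" by (auto dest: pair_no_loops)
qed

lemma
  assumes "pair_graph G" and "pair_graph H"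
  shows pair_graph_tensor_prod: "pair_graph (tensor_prod G H)"
    and pair_graph_ext_tensor_prod: "pair_graph (ext_tensor_prod G H)"
    and pair_graph_disj_prod: "pair_graph (disj_prod G H)"
    and pair_graph_lexicographic_prod: "pair_graph (lexicographic_prod G H)"
  using pair_graph_facts[OF assms(1)] pair_graph_facts[OF assms(2)]
  by (auto intro!: pair_graph_intro symI
      simp: tensor_prod_def ext_tensor_prod_def disj_prod_def lexicographic_prod_def irrefl_def)


section \<open>Induced and semi-induced matchings\<close>

definition matching :: "'a pair_pre_digraph \<Rightarrow> 'a set set \<Rightarrow> bool" where
  "matching G M \<longleftrightarrow> M \<subseteq> edges G \<and> (\<forall>e\<in>M. \<forall>f\<in>M. e \<noteq> f \<longrightarrow> e \<inter> f = {})"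

definition induced_matching :: "'a pair_pre_digraph \<Rightarrow> 'a set set \<Rightarrow> bool" where
  "induced_matching G M \<longleftrightarrow> matching G M \<and>
    (\<forall>u u' v v'. {u, u'} \<in> M \<and> {v, v'} \<in> M \<and> {u, u'} \<noteq> {v, v'} \<longrightarrow>
      {u, v} \<notin> edges G \<and> {u, v'} \<notin> edges G \<and> {u', v} \<notin> edges G \<and> {u', v'} \<notin> edges G)"

definition im :: "'a pair_pre_digraph \<Rightarrow> nat" where
  "im G = Max {card M | M. induced_matching G M}"

definition total_order :: "'a pair_pre_digraph \<Rightarrow> ('a \<Rightarrow> nat) \<Rightarrow> bool" where
  "total_order G \<sigma> \<longleftrightarrow> bij_betw \<sigma> (pverts G) {1..card (pverts G)}"

definition semi_induced_matching ::
  "'a pair_pre_digraph \<Rightarrow> ('a \<Rightarrow> nat) \<Rightarrow> 'a set set \<Rightarrow> bool" where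
  "semi_induced_matching G \<sigma> M \<longleftrightarrow> matching G M \<and>
    (\<forall>u u' v v'. {u, u'} \<in> M \<and> {v, v'} \<in> M \<and> \<sigma> u < \<sigma> u' \<and> \<sigma> u < \<sigma> v \<and> \<sigma> v < \<sigma> v' \<longrightarrow>
      {u, v} \<notin> edges G \<and> {u, v'} \<notin> edges G)"

definition sim_order :: "('a \<Rightarrow> nat) \<Rightarrow> 'a pair_pre_digraph \<Rightarrow> nat" where
  "sim_order \<sigma> G = Max {card M | M. semi_induced_matching G \<sigma> M}"

definition sim :: "'a pair_pre_digraph \<Rightarrow> nat" where
  "sim G = Max {sim_order \<sigma> G | \<sigma>. total_order G \<sigma>}"

text \<open>All the maxima above are taken over finite nonempty sets.\<close>

lemma finite_edges:
  assumes "pair_graph G"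
  shows "finite (edges G)"
proof -
  have "edges G \<subseteq> Pow (pverts G)"
    using pair_graph_facts(2)[OF assms] by (auto simp: edges_def)
  then show ?thesis
    using pair_graph_facts(1)[OF assms] by (simp add: finite_subset)
qed

lemma card_matching_le:
  assumes "pair_graph G" and "matching G M"
  shows "card M \<le> card (edges G)"
  using assms by (auto simp: matching_def intro: card_mono finite_edges)

lemma im_Max_welldefined:
  assumes "pair_graph G"
  shows "finite {card M | M. induced_matching G M}" and "{card M | M. induced_matching G M} \<noteq> {}"
proof -
  show "finite {card M | M. induced_matching G M}"
    by (rule finite_subset[of _ "{..card (edges G)}"])
      (use card_matching_le[OF assms] in \<open>auto simp: induced_matching_def\<close>)
  have "induced_matching G {}" by (simp add: induced_matching_def matching_def)
  then show "{card M | M. induced_matching G M} \<noteq> {}" by blast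
qed

lemma sim_order_Max_welldefined:
  assumes "pair_graph G"
  shows "finite {card M | M. semi_induced_matching G \<sigma> M}"
    and "{card M | M. semi_induced_matching G \<sigma> M} \<noteq> {}"
proof -
  show "finite {card M | M. semi_induced_matching G \<sigma> M}"
    by (rule finite_subset[of _ "{..card (edges G)}"])
      (use card_matching_le[OF assms] in \<open>auto simp: semi_induced_matching_def\<close>)
  have "semi_induced_matching G \<sigma> {}" by (simp add: semi_induced_matching_def matching_def)
  then show "{card M | M. semi_induced_matching G \<sigma> M} \<noteq> {}" by blast
qed

lemma sim_Max_welldefined:
  assumes "pair_graph G"
  shows "finite {sim_order \<sigma> G | \<sigma>. total_order G \<sigma>}"
    and "{sim_order \<sigma> G | \<sigma>. total_order G \<sigma>} \<noteq> {}"
proof -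
  have "sim_order \<sigma> G \<le> card (edges G)" for \<sigma>
  proof -
    have "sim_order \<sigma> G \<in> {card M | M. semi_induced_matching G \<sigma> M}"
      unfolding sim_order_def by (rule Max_in[OF sim_order_Max_welldefined[OF assms]])
    then show ?thesis
      using card_matching_le[OF assms] by (auto simp: semi_induced_matching_def)
  qed
  then show "finite {sim_order \<sigma> G | \<sigma>. total_order G \<sigma>}"
    by (auto intro!: finite_subset[of _ "{..card (edges G)}"])
  have "\<exists>\<sigma>. total_order G \<sigma>"
    unfolding total_order_def
    by (rule finite_same_card_bij) (auto simp: pair_graph_facts(1)[OF assms])
  then show "{sim_order \<sigma> G | \<sigma>. total_order G \<sigma>} \<noteq> {}" by blast
qed


section \<open>Posets and their dimension\<close>

definition poset :: "'a pair_pre_digraph \<Rightarrow> bool" where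
  "poset P \<longleftrightarrow> pair_digraph P \<and> acyclic (parcs P) \<and> trans (parcs P)"

definition minimal_vertex :: "'a pair_pre_digraph \<Rightarrow> 'a \<Rightarrow> bool" where
  "minimal_vertex P v \<longleftrightarrow> v \<in> pverts P \<and> in_degree P v = 0"

definition maximal_vertex :: "'a pair_pre_digraph \<Rightarrow> 'a \<Rightarrow> bool" where
  "maximal_vertex P v \<longleftrightarrow> v \<in> pverts P \<and> out_degree P v = 0"

definition height_two_poset :: "'a pair_pre_digraph \<Rightarrow> bool" where
  "height_two_poset P \<longleftrightarrow>
    poset P \<and> (\<forall>v\<in>pverts P. minimal_vertex P v \<or> maximal_vertex P v)"

text \<open>
  As \<open>d\<close> varies, a point of \<open>d\<close>-dimensional space is a function \<open>nat \<Rightarrow> real\<close> of which only the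
  coordinates with index in \<open>{..<d}\<close> are looked at.
\<close>

definition vec_less :: "nat \<Rightarrow> (nat \<Rightarrow> real) \<Rightarrow> (nat \<Rightarrow> real) \<Rightarrow> bool" where
  "vec_less d p q \<longleftrightarrow> (\<forall>i<d. p i \<le> q i) \<and> (\<exists>j<d. p j < q j)"

text \<open>A realizing map need not be injective.\<close>

definition realizes :: "nat \<Rightarrow> ('a \<Rightarrow> nat \<Rightarrow> real) \<Rightarrow> 'a pair_pre_digraph \<Rightarrow> bool" where
  "realizes d \<phi> P \<longleftrightarrow>
    (\<forall>u\<in>pverts P. \<forall>v\<in>pverts P. u \<noteq> v \<longrightarrow> ((u, v) \<in> parcs P \<longleftrightarrow> vec_less d (\<phi> u) (\<phi> v)))"

text \<open>The dimension \<open>0\<close> is allowed; it is attained exactly by the posets without arcs.\<close>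

definition poset_dim :: "'a pair_pre_digraph \<Rightarrow> nat" where
  "poset_dim P = (LEAST d. \<exists>\<phi>. realizes d \<phi> P)"

lemma poset_realizable:
  assumes "poset P"
  shows "\<exists>d \<phi>. realizes d \<phi> P"
proof -
  interpret pair_digraph P using assms by (simp add: poset_def)
  have tr: "trans (parcs P)" and ac: "acyclic (parcs P)"
    using assms by (simp_all add: poset_def)
  obtain h where h: "bij_betw h {..<card (pverts P)} (pverts P)"
    using ex_bij_betw_nat_finite[OF pair_finite_verts] by (auto simp: atLeast0LessThan)
  let ?le = "\<lambda>u w. u = w \<or> (u, w) \<in> parcs P"
  define \<phi> where "\<phi> = (\<lambda>u i. if ?le u (h i) then 0 else (1::real))"
  have "realizes (card (pverts P)) \<phi> P"
    unfolding realizes_def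
  proof (intro ballI impI iffI)
    fix u v assume uv: "u \<in> pverts P" "v \<in> pverts P" "u \<noteq> v" "(u, v) \<in> parcs P"
    obtain j where j: "j < card (pverts P)" "h j = u"
      using bij_betw_imp_surj_on[OF h] uv(1) by (metis imageE lessThan_iff)
    have "(v, u) \<notin> parcs P"
      using ac uv(4) by (meson acyclic_def r_into_trancl' trancl_into_trancl)
    then show "vec_less (card (pverts P)) (\<phi> u) (\<phi> v)"
      using uv j tr by (auto simp: vec_less_def \<phi>_def dest: transD intro!: exI[of _ j])
  next
    fix u v assume uv: "u \<in> pverts P" "v \<in> pverts P" "u \<noteq> v"
      and l: "vec_less (card (pverts P)) (\<phi> u) (\<phi> v)"
    obtain j where j: "j < card (pverts P)" "h j = v"
      using bij_betw_imp_surj_on[OF h] uv(2) by (metis imageE lessThan_iff)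
    then have "\<phi> u j \<le> \<phi> v j" using l by (simp add: vec_less_def)
    then show "(u, v) \<in> parcs P" using j uv(3) by (auto simp: \<phi>_def split: if_splits)
  qed
  then show ?thesis by blast
qed

lemma poset_ext_tensor_prod:
  assumes "pair_graph G" and "height_two_poset P"
  shows "poset (ext_tensor_prod G P)"
proof -
  interpret P: pair_digraph P using assms by (simp add: poset_def height_two_poset_def)
  have no_path: False if "(a, b) \<in> parcs P" "(b, c) \<in> parcs P" for a b c
  proof -
    have "in_arcs P b \<noteq> {}" "out_arcs P b \<noteq> {}"
      using that by (auto simp: in_arcs_def out_arcs_def)
    moreover have "finite (in_arcs P b)" "finite (out_arcs P b)"
      using P.pair_finite_arcs by (auto simp: in_arcs_def out_arcs_def)
    moreover have "b \<in> pverts P" using that(1) by (rule P.in_arcsD2)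
    moreover have "in_degree P b = 0 \<or> out_degree P b = 0" if "b \<in> pverts P"
      using assms(2) that
      by (auto simp: height_two_poset_def minimal_vertex_def maximal_vertex_def)
    ultimately show False by (simp add: in_degree_def out_degree_def)
  qed
  let ?A = "parcs (ext_tensor_prod G P)"
  have no_path': "(y, z) \<notin> ?A" if "(x, y) \<in> ?A" for x y z
    using that no_path by (auto simp: ext_tensor_prod_def)
  then have tr: "trans ?A" by (meson transI)
  have "(x, x) \<notin> ?A" for x using no_path' by blast
  then have "acyclic ?A" using tr by (simp add: acyclic_def)
  moreover have "pair_digraph (ext_tensor_prod G P)"
  proof -
    have sub: "?A \<subseteq> pverts (ext_tensor_prod G P) \<times> pverts (ext_tensor_prod G P)"
      using P.in_arcsD1 P.in_arcsD2 by (auto simp: ext_tensor_prod_def)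
    have fin: "finite (pverts (ext_tensor_prod G P))"
      using pair_graph_facts(1)[OF assms(1)] P.pair_finite_verts
      by (simp add: ext_tensor_prod_def)
    have "finite ?A" using sub fin by (meson finite_SigmaI finite_subset)
    then show ?thesis
      using sub fin \<open>\<And>x. (x, x) \<notin> ?A\<close> by unfold_locales auto
  qed
  ultimately show ?thesis using tr by (simp add: poset_def)
qed


section \<open>Chromatic number\<close>

definition proper_coloring :: "'a pair_pre_digraph \<Rightarrow> nat \<Rightarrow> ('a \<Rightarrow> nat) \<Rightarrow> bool" where
  "proper_coloring G k c \<longleftrightarrow>
    (\<forall>v\<in>pverts G. c v < k) \<and> (\<forall>u v. (u, v) \<in> parcs G \<longrightarrow> c u \<noteq> c v)"

definition chromatic_number :: "'a pair_pre_digraph \<Rightarrow> nat" where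
  "chromatic_number G = (LEAST k. \<exists>c. proper_coloring G k c)"

end

(*
  Matchings: the projections (u, x, a) -> (u, a) and (u, x, a) -> (x, a) reflect adjacency, and each
  edge of (G \<or> H) \<times> J is mapped to an edge by at least one of them.  The edges of a
  (semi-)induced matching that a given projection preserves are mapped injectively onto a
  (semi-)induced matching: if two of them had images sharing a vertex, the endpoint that must not see
  the other edge would see it.

  Dimension: given realizers f of G \<times>_e P, g of H \<times>_e P, h of P and a proper colouring c
  of G, the vertex (u, x, a) gets the coordinates f (u, a), then for each colour i a block of
  coordinates, then h a.  The block of colour c u is g (x, a); all other blocks are constantly
  -\<infinity> if a has no predecessor in P and +\<infinity> otherwise.
*)
theory Submission
  imports Defs
begin

section \<open>Matchings under adjacency-reflecting maps\<close>

lemma matching_subset: "matching G M \<Longrightarrow> N \<subseteq> M \<Longrightarrow> matching G N"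
  unfolding matching_def by (meson subset_iff)

lemma induced_matching_subset:
  assumes "induced_matching G M" and "N \<subseteq> M"
  shows "induced_matching G N"
proof -
  have "matching G N" using assms matching_subset by (auto simp: induced_matching_def)
  then show ?thesis
    using assms(1) subsetD[OF assms(2)] unfolding induced_matching_def by meson
qed

lemma semi_induced_matching_subset:
  assumes "semi_induced_matching G \<sigma> M" and "N \<subseteq> M"
  shows "semi_induced_matching G \<sigma> N"
proof -
  have "matching G N" using assms matching_subset by (auto simp: semi_induced_matching_def)
  then show ?thesis
    using assms(1) subsetD[OF assms(2)] unfolding semi_induced_matching_def by meson
qed

lemma doubleton_in_edges_iff:
  assumes "pair_graph G"
  shows "{u, v} \<in> edges G \<longleftrightarrow> (u, v) \<in> parcs G"
  using pair_graph_facts(3)[OF assms] by (auto simp: edges_def doubleton_eq_iff)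

text \<open>Reflection makes non-adjacency survive the passage from \<open>K\<close> to
  \<open>L\<close>, which is what inducedness asks for. A projection need not send edges to edges;
  this is assumed separately for the edges at hand.\<close>

definition reflects_adjacency ::
  "('a \<Rightarrow> 'b) \<Rightarrow> 'a pair_pre_digraph \<Rightarrow> 'b pair_pre_digraph \<Rightarrow> bool" where
  "reflects_adjacency \<pi> K L \<longleftrightarrow>
    (\<forall>x\<in>pverts K. \<forall>y\<in>pverts K. (\<pi> x, \<pi> y) \<in> parcs L \<longrightarrow> (x, y) \<in> parcs K)"

lemma matching_edgeE:
  assumes "pair_graph K" and "matching K M" and "e \<in> M" and "x \<in> e"
  obtains y where "e = {x, y}" and "x \<in> pverts K" and "y \<in> pverts K"
proof -
  have "e \<in> edges K" using assms(2,3) by (auto simp: matching_def)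
  then obtain u v where uv: "e = {u, v}" "(u, v) \<in> parcs K" by (auto simp: edges_def)
  have V: "u \<in> pverts K" "v \<in> pverts K"
    using pair_graph_facts(2)[OF assms(1) uv(2)] by auto
  have "x = u \<or> x = v" using assms(4) uv(1) by simp
  then show ?thesis
  proof
    assume "x = u"
    with uv V show ?thesis by (intro that[of v]) simp_all
  next
    assume "x = v"
    with uv V show ?thesis by (intro that[of u]) (simp_all add: insert_commute)
  qed
qed

text \<open>The hypothesis \<open>apart\<close> is a common weakening of what induced and
  semi-induced matchings provide: in one of the two edges, some endpoint sees nothing of the other.
  A common image vertex would let every endpoint of \<open>e\<close> see a vertex of
  \<open>f\<close> and conversely.\<close>

lemma inj_on_Union_matching:
  assumes K: "pair_graph K" and L: "pair_graph L"
    and r: "reflects_adjacency \<pi> K L" and M: "matching K M" and im: "image \<pi> ` M \<subseteq> edges L"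
    and apart: "\<And>e f. e \<in> M \<Longrightarrow> f \<in> M \<Longrightarrow> e \<noteq> f \<Longrightarrow>
      (\<exists>m\<in>e. \<forall>w\<in>f. {m, w} \<notin> edges K) \<or> (\<exists>m\<in>f. \<forall>w\<in>e. {m, w} \<notin> edges K)"
  shows "inj_on \<pi> (\<Union>M)"
proof -
  have adj: "(\<pi> x, \<pi> y) \<in> parcs L" if "{x, y} \<in> M" for x y
  proof -
    have "\<pi> ` {x, y} \<in> edges L" using im that by blast
    then show ?thesis by (simp add: doubleton_in_edges_iff[OF L])
  qed
  have *: False
    if "e \<in> M" "f \<in> M" "x \<in> e" "y \<in> f" "\<pi> x = \<pi> y" "m \<in> e" "\<forall>w\<in>f. {m, w} \<notin> edges K"
    for e f x y m
  proof -
    obtain x' where x': "e = {x, x'}" "x \<in> pverts K" "x' \<in> pverts K"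
      using matching_edgeE[OF K M \<open>e \<in> M\<close> \<open>x \<in> e\<close>] .
    obtain y' where y': "f = {y, y'}" "y \<in> pverts K" "y' \<in> pverts K"
      using matching_edgeE[OF K M \<open>f \<in> M\<close> \<open>y \<in> f\<close>] .
    \<comment> \<open>The two image edges meet in \<open>\<pi> x = \<pi> y\<close>, so their
      remaining endpoints may be exchanged; reflecting the result gives each of \<open>x\<close>,
      \<open>x'\<close> a neighbour in \<open>f\<close>.\<close>
    have "(\<pi> x, \<pi> y') \<in> parcs L" "(\<pi> x', \<pi> y) \<in> parcs L"
      using adj[of x x'] adj[of y y'] that(1,2,5) x'(1) y'(1) pair_graph_facts(3)[OF L] by simp_all
    then have "(x, y') \<in> parcs K" "(x', y) \<in> parcs K"
      using r x' y' by (auto simp: reflects_adjacency_def)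
    then show False
      using that x' y' by (auto simp: doubleton_in_edges_iff[OF K])
  qed
  show ?thesis
  proof (rule inj_onI, rule ccontr)
    fix x y assume "x \<in> \<Union>M" "y \<in> \<Union>M" and eq: "\<pi> x = \<pi> y" and ne: "x \<noteq> y"
    then obtain e f where ef: "e \<in> M" "f \<in> M" "x \<in> e" "y \<in> f" by blast
    show False
    proof (cases "e = f")
      case True
      then have "e = {x, y}" using matching_edgeE[OF K M ef(1,3)] ef(4) ne by blast
      \<comment> \<open>An edge collapsed to a single vertex would have a loop as its image.\<close>
      then show False using adj[of x y] eq ef(1) pair_graph_facts(4)[OF L] by simp
    next
      case False
      then show False using apart[OF ef(1,2)] *[OF ef(1,2,3,4) eq] *[OF ef(2,1,4,3) eq[symmetric]]
        by blast
    qed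
  qed
qed

lemma matching_image:
  assumes "matching K M" and "inj_on \<pi> (\<Union>M)" and "image \<pi> ` M \<subseteq> edges L"
  shows "matching L (image \<pi> ` M)" and "card (image \<pi> ` M) = card M"
proof -
  have "\<pi> ` e \<inter> \<pi> ` f = {}" if "e \<in> M" "f \<in> M" "\<pi> ` e \<noteq> \<pi> ` f" for e f
  proof -
    have "\<pi> ` (e \<inter> f) = \<pi> ` e \<inter> \<pi> ` f"
      using that(1,2) by (intro inj_on_image_Int[OF assms(2)]) auto
    moreover have "e \<noteq> f" using that(3) by blast
    then have "e \<inter> f = {}" using assms(1) that(1,2) by (simp add: matching_def)
    ultimately show ?thesis by simp
  qed
  then show "matching L (image \<pi> ` M)"
    using assms(3) by (simp add: matching_def)
  have "inj_on (image \<pi>) M"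
    using inj_on_image_Pow[OF assms(2)] by (rule inj_on_subset) auto
  then show "card (image \<pi> ` M) = card M" by (rule card_image)
qed

lemma image_edgeE:
  assumes "pair_graph K" and "matching K M" and "{U, U'} \<in> image \<pi> ` M"
  obtains u u' where "{u, u'} \<in> M" "U = \<pi> u" "U' = \<pi> u'" "u \<in> pverts K" "u' \<in> pverts K"
proof -
  obtain e where e: "e \<in> M" "{U, U'} = \<pi> ` e" using assms(3) by blast
  then obtain u where u: "u \<in> e" "U = \<pi> u" by blast
  obtain u' where "e = {u, u'}" "u \<in> pverts K" "u' \<in> pverts K"
    using matching_edgeE[OF assms(1,2) e(1) u(1)] .
  with that[of u u'] e u show ?thesis by (auto simp: doubleton_eq_iff)
qed

text \<open>Injectivity on the covered vertices keeps the image a matching of the same size, and an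
  edge of \<open>L\<close> joining two image edges would be reflected to an edge of \<open>K\<close>
  joining their preimages.\<close>

lemma induced_matching_image:
  assumes K: "pair_graph K" and L: "pair_graph L"
    and r: "reflects_adjacency \<pi> K L" and M: "induced_matching K M"
    and im: "image \<pi> ` M \<subseteq> edges L"
  shows "induced_matching L (image \<pi> ` M)" and "card (image \<pi> ` M) = card M"
proof -
  have m: "matching K M" using M by (simp add: induced_matching_def)
  have nadj: "{u, v} \<notin> edges K \<and> {u, v'} \<notin> edges K \<and> {u', v} \<notin> edges K \<and> {u', v'} \<notin> edges K"
    if "{u, u'} \<in> M" "{v, v'} \<in> M" "{u, u'} \<noteq> {v, v'}" for u u' v v'
    using M that unfolding induced_matching_def by blast
  have inj: "inj_on \<pi> (\<Union>M)"
  proof (rule inj_on_Union_matching[OF K L r m im])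
    fix e f assume ef: "e \<in> M" "f \<in> M" "e \<noteq> f"
    then obtain u u' v v' where "e = {u, u'}" "f = {v, v'}"
      using m by (fastforce simp: matching_def edges_def)
    then show "(\<exists>m\<in>e. \<forall>w\<in>f. {m, w} \<notin> edges K) \<or> (\<exists>m\<in>f. \<forall>w\<in>e. {m, w} \<notin> edges K)"
      using nadj[of u u' v v'] ef by blast
  qed
  show "card (image \<pi> ` M) = card M" by (rule matching_image(2)[OF m inj im])
  show "induced_matching L (image \<pi> ` M)"
    unfolding induced_matching_def
  proof (intro conjI[OF matching_image(1)[OF m inj im]] allI impI, elim conjE)
    fix U U' V V'
    assume UV: "{U, U'} \<in> image \<pi> ` M" "{V, V'} \<in> image \<pi> ` M" "{U, U'} \<noteq> {V, V'}"
    obtain u u' where u: "{u, u'} \<in> M" "U = \<pi> u" "U' = \<pi> u'" "u \<in> pverts K" "u' \<in> pverts K"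
      using image_edgeE[OF K m UV(1)] .
    obtain v v' where v: "{v, v'} \<in> M" "V = \<pi> v" "V' = \<pi> v'" "v \<in> pverts K" "v' \<in> pverts K"
      using image_edgeE[OF K m UV(2)] .
    have "{u, u'} \<noteq> {v, v'}" using UV(3) u v by (auto simp: doubleton_eq_iff)
    then show "{U, V} \<notin> edges L \<and> {U, V'} \<notin> edges L \<and> {U', V} \<notin> edges L \<and> {U', V'} \<notin> edges L"
      using nadj[OF u(1) v(1)] u v r
      by (auto simp: doubleton_in_edges_iff[OF K] doubleton_in_edges_iff[OF L] reflects_adjacency_def)
  qed
qed

text \<open>Turns a ranking with ties into a bijection onto an initial segment: elements are
  inserted by increasing value of \<open>f\<close>, and each new one receives the last
  position.\<close>

lemma ex_ranking_refining:
  fixes f :: "'a \<Rightarrow> nat"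
  assumes "finite A"
  shows "\<exists>\<tau>. bij_betw \<tau> A {1..card A} \<and> (\<forall>x\<in>A. \<forall>y\<in>A. f x < f y \<longrightarrow> \<tau> x < \<tau> y)"
  using assms
proof (induction A rule: finite_ranking_induct[where f = f])
  case (insert x S)
  show ?case
  proof (cases "x \<in> S")
    \<comment> \<open>The induction rule does not guarantee that the inserted element is
      new.\<close>
    case True
    then show ?thesis using insert.IH by (simp add: insert_absorb)
  next
    case False
    obtain \<tau> where \<tau>: "bij_betw \<tau> S {1..card S}" "\<forall>x\<in>S. \<forall>y\<in>S. f x < f y \<longrightarrow> \<tau> x < \<tau> y"
      using insert.IH by blast
    let ?\<tau> = "\<tau>(x := Suc (card S))"
    have le: "\<tau> y \<le> card S" if "y \<in> S" for y using bij_betwE[OF \<tau>(1)] that by auto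
    have "bij_betw ?\<tau> S {1..card S}"
      using \<tau>(1) False by (subst bij_betw_cong[of S ?\<tau> \<tau>]) auto
    then have "bij_betw ?\<tau> (insert x S) (insert (Suc (card S)) {1..card S})"
      using notIn_Un_bij_betw[of x S ?\<tau> "{1..card S}"] False by simp
    then have "bij_betw ?\<tau> (insert x S) {1..card (insert x S)}"
      using False insert.hyps by (simp add: atLeastAtMostSuc_conv)
    moreover have "?\<tau> y < ?\<tau> z" if "y \<in> insert x S" "z \<in> insert x S" "f y < f z" for y z
      using that \<tau>(2) le False insert.hyps(2) by (fastforce simp: less_Suc_eq_le)
    ultimately show ?thesis by blast
  qed
qed (simp add: bij_betw_def)

text \<open>The order on \<open>L\<close> has to be built: it copies \<open>\<sigma>\<close> on the
  images of the covered vertices, so every order pattern in the image comes from the same pattern in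
  \<open>M\<close>.\<close>

lemma semi_induced_matching_image:
  assumes K: "pair_graph K" and L: "pair_graph L"
    and r: "reflects_adjacency \<pi> K L" and \<sigma>: "total_order K \<sigma>"
    and M: "semi_induced_matching K \<sigma> M" and im: "image \<pi> ` M \<subseteq> edges L"
  shows "\<exists>\<tau>. total_order L \<tau> \<and> semi_induced_matching L \<tau> (image \<pi> ` M)"
    and "card (image \<pi> ` M) = card M"
proof -
  have m: "matching K M" using M by (simp add: semi_induced_matching_def)
  have \<sigma>_inj: "\<sigma> x = \<sigma> y \<longleftrightarrow> x = y" if "x \<in> pverts K" "y \<in> pverts K" for x y
    using \<sigma> that by (auto simp: total_order_def bij_betw_def inj_on_def)
  have nadj: "{u, v} \<notin> edges K \<and> {u, v'} \<notin> edges K"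
    if "{u, u'} \<in> M" "{v, v'} \<in> M" "\<sigma> u < \<sigma> u'" "\<sigma> u < \<sigma> v" "\<sigma> v < \<sigma> v'" for u u' v v'
    using M that unfolding semi_induced_matching_def by blast
  have orient: "\<exists>u u'. e = {u, u'} \<and> \<sigma> u < \<sigma> u' \<and> u \<in> pverts K" if "e \<in> M" for e
  proof -
    have "e \<in> edges K" using m that by (auto simp: matching_def)
    then obtain u u' where e: "e = {u, u'}" "(u, u') \<in> parcs K" by (auto simp: edges_def)
    then have V: "u \<in> pverts K" "u' \<in> pverts K" "u \<noteq> u'"
      using pair_graph_facts(2,4)[OF K] by auto
    show ?thesis
    proof (cases "\<sigma> u < \<sigma> u'")
      case True
      then show ?thesis using e V by blast
    next
      case False
      then have "\<sigma> u' < \<sigma> u" using \<sigma>_inj[OF V(1,2)] V(3) by simp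
      then show ?thesis using e V by (metis insert_commute)
    qed
  qed
  have inj: "inj_on \<pi> (\<Union>M)"
  proof (rule inj_on_Union_matching[OF K L r m im])
    fix e f assume ef: "e \<in> M" "f \<in> M" "e \<noteq> f"
    obtain u u' where u: "e = {u, u'}" "\<sigma> u < \<sigma> u'" "u \<in> pverts K" using orient[OF ef(1)] by blast
    obtain v v' where v: "f = {v, v'}" "\<sigma> v < \<sigma> v'" "v \<in> pverts K" using orient[OF ef(2)] by blast
    have "e \<inter> f = {}" using m ef by (simp add: matching_def)
    \<comment> \<open>Of the lower endpoints of the two edges, the one that comes first under
      \<open>\<sigma>\<close> has no neighbour in the other edge; this is the witness for
      \<open>apart\<close>.\<close>
    then have "u \<noteq> v" using u(1) v(1) by blast
    then consider "\<sigma> u < \<sigma> v" | "\<sigma> v < \<sigma> u" using \<sigma>_inj[OF u(3) v(3)] by linarith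
    then show "(\<exists>m\<in>e. \<forall>w\<in>f. {m, w} \<notin> edges K) \<or> (\<exists>m\<in>f. \<forall>w\<in>e. {m, w} \<notin> edges K)"
    proof cases
      case 1
      then show ?thesis using nadj[of u u' v v'] u v ef by blast
    next
      case 2
      then show ?thesis using nadj[of v v' u u'] u v ef by blast
    qed
  qed
  show "card (image \<pi> ` M) = card M" by (rule matching_image(2)[OF m inj im])
  \<comment> \<open>This pulls \<open>\<sigma>\<close> over to \<open>L\<close> along the inverse of
    \<open>\<pi>\<close>. The default 0 is arbitrary, since vertices outside the image lie on no
    edge of the image matching.\<close>
  define f where
    "f w = (if w \<in> \<pi> ` \<Union>M then \<sigma> (inv_into (\<Union>M) \<pi> w) else 0)" for w
  have f: "f (\<pi> x) = \<sigma> x" if "x \<in> \<Union>M" for x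
    using that inj by (simp add: f_def)
  obtain \<tau> where \<tau>: "total_order L \<tau>"
    "\<And>x y. x \<in> pverts L \<Longrightarrow> y \<in> pverts L \<Longrightarrow> f x < f y \<Longrightarrow> \<tau> x < \<tau> y"
    using ex_ranking_refining[OF pair_graph_facts(1)[OF L], of f] unfolding total_order_def by blast
  have L_vert: "\<pi> x \<in> pverts L" if x: "x \<in> \<Union>M" for x
  proof -
    obtain e where e: "e \<in> M" "x \<in> e" using x by blast
    then have "\<pi> ` e \<in> edges L" using im by blast
    then obtain u v where uv: "\<pi> ` e = {u, v}" "(u, v) \<in> parcs L" by (auto simp: edges_def)
    have "\<pi> x \<in> {u, v}" using e(2) uv(1) by blast
    then show ?thesis using pair_graph_facts(2)[OF L uv(2)] by auto
  qed
  \<comment> \<open>Although \<open>\<tau>\<close> only refines \<open>f\<close>, it also reflects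
    the order here, because \<open>\<sigma>\<close> has no ties among vertices of
    \<open>K\<close>.\<close>
  have ord: "\<sigma> x < \<sigma> y"
    if "x \<in> \<Union>M" "y \<in> \<Union>M" "x \<in> pverts K" "y \<in> pverts K" "\<tau> (\<pi> x) < \<tau> (\<pi> y)" for x y
    using \<tau>(2)[of "\<pi> y" "\<pi> x"] f[OF that(1)] f[OF that(2)] L_vert that \<sigma>_inj[OF that(3,4)]
    by (metis less_asym linorder_neqE_nat)
  have "semi_induced_matching L \<tau> (image \<pi> ` M)"
    unfolding semi_induced_matching_def
  proof (intro conjI[OF matching_image(1)[OF m inj im]] allI impI, elim conjE)
    fix U U' V V'
    assume UV: "{U, U'} \<in> image \<pi> ` M" "{V, V'} \<in> image \<pi> ` M"
      and lt: "\<tau> U < \<tau> U'" "\<tau> U < \<tau> V" "\<tau> V < \<tau> V'"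
    obtain u u' where u: "{u, u'} \<in> M" "U = \<pi> u" "U' = \<pi> u'" "u \<in> pverts K" "u' \<in> pverts K"
      using image_edgeE[OF K m UV(1)] .
    obtain v v' where v: "{v, v'} \<in> M" "V = \<pi> v" "V' = \<pi> v'" "v \<in> pverts K" "v' \<in> pverts K"
      using image_edgeE[OF K m UV(2)] .
    have W: "u \<in> \<Union>M" "u' \<in> \<Union>M" "v \<in> \<Union>M" "v' \<in> \<Union>M" using u(1) v(1) by blast+
    have "{u, v} \<notin> edges K \<and> {u, v'} \<notin> edges K"
      using nadj[OF u(1) v(1)] ord W u v lt by blast
    then show "{U, V} \<notin> edges L \<and> {U, V'} \<notin> edges L"
      using u v r
      by (auto simp: doubleton_in_edges_iff[OF K] doubleton_in_edges_iff[OF L] reflects_adjacency_def)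
  qed
  then show "\<exists>\<tau>. total_order L \<tau> \<and> semi_induced_matching L \<tau> (image \<pi> ` M)"
    using \<tau>(1) by blast
qed

section \<open>Bounds on \<open>im\<close> and \<open>sim\<close> from two projections\<close>

lemma card_le_im:
  assumes "pair_graph G" and "induced_matching G M"
  shows "card M \<le> im G"
  unfolding im_def using im_Max_welldefined[OF assms(1)] assms(2) by (auto intro: Max_ge)

lemma im_attained:
  assumes "pair_graph G"
  obtains M where "induced_matching G M" and "card M = im G"
  using Max_in[OF im_Max_welldefined[OF assms]] unfolding im_def by force

lemma card_le_sim:
  assumes "pair_graph G" and "total_order G \<sigma>" and "semi_induced_matching G \<sigma> M"
  shows "card M \<le> sim G"
proof -
  have "card M \<le> sim_order \<sigma> G"
    unfolding sim_order_def using sim_order_Max_welldefined[OF assms(1)] assms(3)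
    by (auto intro: Max_ge)
  also have "\<dots> \<le> sim G"
    unfolding sim_def using sim_Max_welldefined[OF assms(1)] assms(2) by (auto intro: Max_ge)
  finally show ?thesis .
qed

lemma sim_attained:
  assumes "pair_graph G"
  obtains \<sigma> M where "total_order G \<sigma>" and "semi_induced_matching G \<sigma> M" and "card M = sim G"
proof -
  obtain \<sigma> where \<sigma>: "total_order G \<sigma>" "sim G = sim_order \<sigma> G"
    using Max_in[OF sim_Max_welldefined[OF assms]] unfolding sim_def by force
  moreover obtain M where "semi_induced_matching G \<sigma> M" "sim_order \<sigma> G = card M"
    using Max_in[OF sim_order_Max_welldefined[OF assms, of \<sigma>]] unfolding sim_order_def by force
  ultimately show ?thesis using that by simp
qed

lemma card_le_card_filter_add:
  assumes "finite M" and "\<And>e. e \<in> M \<Longrightarrow> P e \<or> Q e"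
  shows "card M \<le> card {e \<in> M. P e} + card {e \<in> M. Q e}"
proof -
  have "M = {e \<in> M. P e} \<union> {e \<in> M. Q e}" using assms(2) by blast
  then show ?thesis by (metis card_Un_le)
qed

text \<open>An optimal matching of \<open>K\<close> is covered by the edges that
  \<open>\<pi>\<close> preserves and those that \<open>\<pi>'\<close> preserves. Each class is again
  (semi-)induced and has an image of equal size. For \<open>sim\<close>, the orders on
  \<open>L\<close> and \<open>L'\<close> are obtained independently of each other.\<close>

lemma
  assumes K: "pair_graph K" and L: "pair_graph L" and L': "pair_graph L'"
    and r: "reflects_adjacency \<pi> K L" and r': "reflects_adjacency \<pi>' K L'"
    and cover: "\<And>e. e \<in> edges K \<Longrightarrow> \<pi> ` e \<in> edges L \<or> \<pi>' ` e \<in> edges L'"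
  shows im_le_add: "im K \<le> im L + im L'"
    and sim_le_add: "sim K \<le> sim L + sim L'"
proof -
  have split: "card M \<le> card {e \<in> M. \<pi> ` e \<in> edges L} + card {e \<in> M. \<pi>' ` e \<in> edges L'}"
    if "matching K M" for M
  proof (rule card_le_card_filter_add)
    have "M \<subseteq> edges K" using that by (simp add: matching_def)
    then show "finite M" using finite_edges[OF K] by (rule finite_subset)
    show "\<pi> ` e \<in> edges L \<or> \<pi>' ` e \<in> edges L'" if "e \<in> M" for e
      using that cover \<open>M \<subseteq> edges K\<close> by blast
  qed
  show "im K \<le> im L + im L'"
  proof -
    obtain M where M: "induced_matching K M" "card M = im K" using im_attained[OF K] .
    have sub: "induced_matching K {e \<in> M. P e}" for P
      using M(1) by (rule induced_matching_subset) blast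
    have "card {e \<in> M. \<pi> ` e \<in> edges L} \<le> im L"
    proof -
      have "image \<pi> ` {e \<in> M. \<pi> ` e \<in> edges L} \<subseteq> edges L" by blast
      note img = induced_matching_image[OF K L r sub this]
      show ?thesis using card_le_im[OF L img(1)] unfolding img(2) .
    qed
    moreover have "card {e \<in> M. \<pi>' ` e \<in> edges L'} \<le> im L'"
    proof -
      have "image \<pi>' ` {e \<in> M. \<pi>' ` e \<in> edges L'} \<subseteq> edges L'" by blast
      note img = induced_matching_image[OF K L' r' sub this]
      show ?thesis using card_le_im[OF L' img(1)] unfolding img(2) .
    qed
    ultimately show ?thesis using split[of M] M by (simp add: induced_matching_def)
  qed
  show "sim K \<le> sim L + sim L'"
  proof -
    obtain \<sigma> M where M: "total_order K \<sigma>" "semi_induced_matching K \<sigma> M" "card M = sim K"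
      using sim_attained[OF K] .
    have sub: "semi_induced_matching K \<sigma> {e \<in> M. P e}" for P
      using M(2) by (rule semi_induced_matching_subset) blast
    have "card {e \<in> M. \<pi> ` e \<in> edges L} \<le> sim L"
    proof -
      have "image \<pi> ` {e \<in> M. \<pi> ` e \<in> edges L} \<subseteq> edges L" by blast
      note img = semi_induced_matching_image[OF K L r M(1) sub this]
      from img(1) show ?thesis using card_le_sim[OF L] unfolding img(2)[symmetric] by blast
    qed
    moreover have "card {e \<in> M. \<pi>' ` e \<in> edges L'} \<le> sim L'"
    proof -
      have "image \<pi>' ` {e \<in> M. \<pi>' ` e \<in> edges L'} \<subseteq> edges L'" by blast
      note img = semi_induced_matching_image[OF K L' r' M(1) sub this]
      from img(1) show ?thesis using card_le_sim[OF L'] unfolding img(2)[symmetric] by blast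
    qed
    ultimately show ?thesis using split[of M] M by (simp add: semi_induced_matching_def)
  qed
qed

text \<open>Both projections keep the \<open>J\<close> coordinate. Adjacency in either factor
  suffices in the disjunctive product, hence both reflect adjacency; some factor must be adjacent,
  hence one of them preserves each edge.\<close>

lemma
  assumes G: "pair_graph G" and H: "pair_graph H" and J: "pair_graph J"
  shows im_tensor_disj_prod_le:
      "im (tensor_prod (disj_prod G H) J) \<le> im (tensor_prod G J) + im (tensor_prod H J)"
    and sim_tensor_disj_prod_le:
      "sim (tensor_prod (disj_prod G H) J) \<le> sim (tensor_prod G J) + sim (tensor_prod H J)"
proof -
  let ?K = "tensor_prod (disj_prod G H) J"
  let ?\<pi> = "\<lambda>((u, x), a). (u, a)" and ?\<pi>' = "\<lambda>((u, x), a). (x, a)"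
  note graphs = pair_graph_tensor_prod[OF pair_graph_disj_prod[OF G H] J]
    pair_graph_tensor_prod[OF G J] pair_graph_tensor_prod[OF H J]
  have "reflects_adjacency ?\<pi> ?K (tensor_prod G J)" "reflects_adjacency ?\<pi>' ?K (tensor_prod H J)"
    by (auto simp: reflects_adjacency_def tensor_prod_def disj_prod_def)
  moreover have "?\<pi> ` e \<in> edges (tensor_prod G J) \<or> ?\<pi>' ` e \<in> edges (tensor_prod H J)"
    if "e \<in> edges ?K" for e
  proof -
    obtain u x a v y b where e: "e = {((u, x), a), ((v, y), b)}"
      and ab: "(a, b) \<in> parcs J" and uv: "(u, v) \<in> parcs G \<or> (x, y) \<in> parcs H"
    proof -
      obtain p q where pq: "e = {p, q}" "(p, q) \<in> parcs ?K"
        using \<open>e \<in> edges ?K\<close> by (auto simp: edges_def)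
      from pq(2) obtain u x a v y b where "p = ((u, x), a)" "q = ((v, y), b)"
        "(a, b) \<in> parcs J" "(u, v) \<in> parcs G \<or> (x, y) \<in> parcs H"
        by (auto simp: tensor_prod_def disj_prod_def)
      with pq(1) show ?thesis using that by blast
    qed
    then have "((u, a), (v, b)) \<in> parcs (tensor_prod G J) \<or> ((x, a), (y, b)) \<in> parcs (tensor_prod H J)"
      by (auto simp: tensor_prod_def)
    then show ?thesis
      by (simp add: e doubleton_in_edges_iff[OF graphs(2)] doubleton_in_edges_iff[OF graphs(3)])
  qed
  ultimately show "im ?K \<le> im (tensor_prod G J) + im (tensor_prod H J)"
    and "sim ?K \<le> sim (tensor_prod G J) + sim (tensor_prod H J)"
    using im_le_add[OF graphs] sim_le_add[OF graphs] by blast+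
qed

section \<open>Dimension of lexicographic products\<close>

text \<open>Allows coordinates to be indexed by any finite set, so that blocks can be assembled as a
  disjoint sum without index arithmetic.\<close>

lemma poset_dim_le_card:
  fixes f :: "'a \<Rightarrow> 'i \<Rightarrow> real"
  assumes "finite I"
    and "\<And>p q. p \<in> pverts Q \<Longrightarrow> q \<in> pverts Q \<Longrightarrow> p \<noteq> q \<Longrightarrow>
      (p, q) \<in> parcs Q \<longleftrightarrow> (\<forall>i\<in>I. f p i \<le> f q i) \<and> (\<exists>i\<in>I. f p i < f q i)"
  shows "poset_dim Q \<le> card I"
proof -
  define N where "N = card I"
  obtain h where "bij_betw h {0..<N} I"
    using ex_bij_betw_nat_finite[OF assms(1)] unfolding N_def ..
  then have I: "I = h ` {..<N}" by (simp add: bij_betw_def atLeast0LessThan)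
  have "realizes N (\<lambda>p n. f p (h n)) Q"
    unfolding realizes_def vec_less_def
  proof (intro ballI impI)
    fix p q assume "p \<in> pverts Q" "q \<in> pverts Q" "p \<noteq> q"
    from assms(2)[OF this] show "(p, q) \<in> parcs Q \<longleftrightarrow>
      (\<forall>n<N. f p (h n) \<le> f q (h n)) \<and> (\<exists>n<N. f p (h n) < f q (h n))"
      by (auto simp: I)
  qed
  then have "poset_dim Q \<le> N"
    unfolding poset_dim_def by (intro Least_le exI)
  then show ?thesis by (simp only: N_def)
qed

lemma poset_dim_attained:
  assumes "poset Q"
  obtains \<phi> where "realizes (poset_dim Q) \<phi> Q"
  using LeastI_ex[OF poset_realizable[OF assms]] unfolding poset_dim_def by blast

lemma chromatic_number_attained:
  assumes "pair_graph G"
  obtains c where "proper_coloring G (chromatic_number G) c"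
proof -
  obtain h where "bij_betw h (pverts G) {..<card (pverts G)}"
    using ex_bij_betw_finite_nat[OF pair_graph_facts(1)[OF assms]] by (auto simp: atLeast0LessThan)
  then have "proper_coloring G (card (pverts G)) h"
    using pair_graph_facts(2,4)[OF assms]
    by (auto simp: proper_coloring_def bij_betw_def dest: inj_onD)
  then have "\<exists>k c. proper_coloring G k c" by blast
  from LeastI_ex[OF this] show ?thesis using that unfolding chromatic_number_def by blast
qed

text \<open>The middle vertex would be neither minimal nor maximal. Taking the same arc twice also
  excludes loops.\<close>

lemma height_two_poset_no_path:
  assumes "height_two_poset P" and "(a, b) \<in> parcs P" and "(b, c) \<in> parcs P"
  shows False
proof -
  interpret P: pair_digraph P using assms by (simp add: poset_def height_two_poset_def)
  have "in_arcs P b \<noteq> {}" "out_arcs P b \<noteq> {}"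
    using assms(2,3) by (auto simp: in_arcs_def out_arcs_def)
  moreover have "finite (in_arcs P b)" "finite (out_arcs P b)"
    using P.pair_finite_arcs by (auto simp: in_arcs_def out_arcs_def)
  moreover have "b \<in> pverts P" using assms(2) by (rule P.in_arcsD2)
  then have "in_degree P b = 0 \<or> out_degree P b = 0"
    using assms(1) by (auto simp: height_two_poset_def minimal_vertex_def maximal_vertex_def)
  ultimately show False by (simp add: in_degree_def out_degree_def)
qed

text \<open>Replacing the strict coordinate by failure of equality lets blocks of coordinates be
  handled through \<le> and = alone.\<close>

lemma realizes_iff:
  assumes "realizes d \<phi> Q" and "u \<in> pverts Q" and "v \<in> pverts Q" and "u \<noteq> v"
  shows "(u, v) \<in> parcs Q \<longleftrightarrow> (\<forall>i<d. \<phi> u i \<le> \<phi> v i) \<and> \<not> (\<forall>i<d. \<phi> u i = \<phi> v i)"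
  using assms by (auto simp: realizes_def vec_less_def order_less_le)

text \<open>
  An arc of P from a to b would put (v, a) strictly below (v, b), hence below (u, a), although no
  two vertices with the same second component are comparable.
\<close>
lemma ext_tensor_realizer_neq:
  assumes P: "height_two_poset P" and \<phi>: "realizes d \<phi> (ext_tensor_prod G P)"
    and u: "u \<in> pverts G" and v: "v \<in> pverts G" and ab: "(a, b) \<in> parcs P"
  shows "\<not> (\<forall>i<d. \<phi> (u, a) i = \<phi> (v, b) i)"
proof
  assume eq: "\<forall>i<d. \<phi> (u, a) i = \<phi> (v, b) i"
  interpret P: pair_digraph P using P by (simp add: poset_def height_two_poset_def)
  have V: "a \<in> pverts P" "b \<in> pverts P" and ne: "a \<noteq> b"
    using P.in_arcsD1[OF ab] P.in_arcsD2[OF ab] ab height_two_poset_no_path[OF P ab] by auto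
  have "(\<forall>i<d. \<phi> (v, a) i \<le> \<phi> (v, b) i) \<and> \<not> (\<forall>i<d. \<phi> (v, a) i = \<phi> (v, b) i)"
    using realizes_iff[OF \<phi>, of "(v, a)" "(v, b)"] V ne v ab by (auto simp: ext_tensor_prod_def)
  then have lt: "(\<forall>i<d. \<phi> (v, a) i \<le> \<phi> (u, a) i) \<and> \<not> (\<forall>i<d. \<phi> (v, a) i = \<phi> (u, a) i)"
    using eq by auto
  then have "v \<noteq> u" by auto
  with lt have "((v, a), (u, a)) \<in> parcs (ext_tensor_prod G P)"
    using realizes_iff[OF \<phi>, of "(v, a)" "(u, a)"] V u v by (auto simp: ext_tensor_prod_def)
  then show False using height_two_poset_no_path[OF P] by (auto simp: ext_tensor_prod_def)
qed

text \<open>Weak domination means either an arc or equal points, and equal points are impossible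
  over an arc of \<open>P\<close>. Thus the pair \<open>a\<close>, \<open>b\<close> alone decides
  which alternative holds.\<close>

lemma ext_tensor_realizer_le_cases:
  assumes P: "height_two_poset P" and \<phi>: "realizes d \<phi> (ext_tensor_prod G P)"
    and u: "u \<in> pverts G" "v \<in> pverts G" and a: "a \<in> pverts P" "b \<in> pverts P"
    and le: "\<forall>i<d. \<phi> (u, a) i \<le> \<phi> (v, b) i"
  shows "(a, b) \<in> parcs P \<and> (u = v \<or> (u, v) \<in> parcs G)
    \<or> (a, b) \<notin> parcs P \<and> (\<forall>i<d. \<phi> (u, a) i = \<phi> (v, b) i)"
proof (cases "\<forall>i<d. \<phi> (u, a) i = \<phi> (v, b) i")
  case True
  then show ?thesis using ext_tensor_realizer_neq[OF P \<phi> u] by blast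
next
  case False
  then have "(u, a) \<noteq> (v, b)" by auto
  then have "((u, a), (v, b)) \<in> parcs (ext_tensor_prod G P)"
    using realizes_iff[OF \<phi>, of "(u, a)" "(v, b)"] u a le False by (auto simp: ext_tensor_prod_def)
  then show ?thesis by (auto simp: ext_tensor_prod_def)
qed

text \<open>A third vertex is compared with \<open>a\<close> and \<open>b\<close> through the same
  coordinates, while between \<open>a\<close> and \<open>b\<close> there is no arc. This is needed
  because realizers may identify vertices.\<close>

lemma realizer_twins:
  assumes P: "poset P" and \<phi>: "realizes d \<phi> P" and a: "a \<in> pverts P" "b \<in> pverts P"
    and eq: "\<forall>i<d. \<phi> a i = \<phi> b i"
  shows "(c, a) \<in> parcs P \<longleftrightarrow> (c, b) \<in> parcs P"
proof (cases "a = b")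
  case False
  interpret P: pair_digraph P using P by (simp add: poset_def)
  have nab: "(a, b) \<notin> parcs P" "(b, a) \<notin> parcs P"
    using realizes_iff[OF \<phi> a False] realizes_iff[OF \<phi> a(2,1)] False eq by auto
  show ?thesis
  proof (cases "c \<in> pverts P \<and> c \<noteq> a \<and> c \<noteq> b")
    case True
    then show ?thesis using realizes_iff[OF \<phi>, of c a] realizes_iff[OF \<phi>, of c b] a eq by auto
  next
    case False
    have "(x, x) \<notin> parcs P" for x using P by (auto simp: poset_def acyclic_def)
    with False nab show ?thesis using P.in_arcsD1 by blast
  qed
qed simp

text \<open>If \<open>P\<close> has an arc from \<open>a\<close> to \<open>b\<close>, the
  \<open>f\<close> block tests whether \<open>u\<close> and \<open>v\<close> are equal or adjacent,
  and for \<open>u = v\<close> the block of their colour tests the \<open>H\<close> side. Without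
  such an arc, weak domination forces equality in every block, so no strict relation arises.\<close>

lemma poset_dim_ext_tensor_lexicographic_prod_le:
  assumes G: "pair_graph G" and H: "pair_graph H" and P: "height_two_poset P"
  shows "poset_dim (ext_tensor_prod (lexicographic_prod G H) P)
    \<le> poset_dim (ext_tensor_prod G P)
      + chromatic_number G * poset_dim (ext_tensor_prod H P) + poset_dim P"
proof -
  define d1 d2 d3 k where d: "d1 = poset_dim (ext_tensor_prod G P)"
    "d2 = poset_dim (ext_tensor_prod H P)" "d3 = poset_dim P" "k = chromatic_number G"
  obtain f where f: "realizes d1 f (ext_tensor_prod G P)"
    using poset_dim_attained[OF poset_ext_tensor_prod[OF G P]] unfolding d .
  obtain g where g: "realizes d2 g (ext_tensor_prod H P)"
    using poset_dim_attained[OF poset_ext_tensor_prod[OF H P]] unfolding d .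
  have poset: "poset P" using P by (simp add: height_two_poset_def)
  obtain h where h: "realizes d3 h P" using poset_dim_attained[OF poset] unfolding d .
  obtain c where c: "proper_coloring G k c" using chromatic_number_attained[OF G] unfolding d .
  interpret P: pair_digraph P using poset by (simp add: poset_def)
  define top where "top a \<longleftrightarrow> (\<exists>z. (z, a) \<in> parcs P)" for a
  \<comment> \<open>Squeezing g into the interval from -2 to 2 by arctan lets 2 and -2 play the role of infinity.\<close>
  define \<psi> where "\<psi> = (\<lambda>((u, x), a) i j.
    if i = c u then arctan (g (x, a) j) else if top a then 2 else -2)"
  define F where "F = (\<lambda>p. case_sum (\<lambda>i. f (fst (fst p), snd p) i)
    (case_sum (\<lambda>(i, j). \<psi> p i j) (\<lambda>i. h (snd p) i)))"
  define I where "I = {..<d1} <+> (({..<k} \<times> {..<d2}) <+> {..<d3})"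
  have bound: "-2 < arctan t" "arctan t < 2" for t
    using arctan_bounded[of t] pi_less_4 by auto
  let ?Q = "ext_tensor_prod (lexicographic_prod G H) P"
  have arc: "(((u, x), a), ((v, y), b)) \<in> parcs ?Q
      \<longleftrightarrow> (\<forall>i\<in>I. F ((u, x), a) i \<le> F ((v, y), b) i) \<and> (\<exists>i\<in>I. F ((u, x), a) i < F ((v, y), b) i)"
    if u: "u \<in> pverts G" "v \<in> pverts G" and x: "x \<in> pverts H" "y \<in> pverts H"
      and a: "a \<in> pverts P" "b \<in> pverts P" and ne: "((u, x), a) \<noteq> ((v, y), b)" for u v x y a b
  proof -
    let ?fle = "\<forall>i<d1. f (u, a) i \<le> f (v, b) i" and ?feq = "\<forall>i<d1. f (u, a) i = f (v, b) i"
    let ?gle = "\<forall>i<d2. g (x, a) i \<le> g (y, b) i" and ?geq = "\<forall>i<d2. g (x, a) i = g (y, b) i"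
    let ?hle = "\<forall>i<d3. h a i \<le> h b i" and ?heq = "\<forall>i<d3. h a i = h b i"
    let ?\<psi>le = "\<forall>i<k. \<forall>j<d2. \<psi> ((u, x), a) i j \<le> \<psi> ((v, y), b) i j"
    let ?\<psi>eq = "\<forall>i<k. \<forall>j<d2. \<psi> ((u, x), a) i j = \<psi> ((v, y), b) i j"
    have cu: "c u < k" "c v < k" using c u by (auto simp: proper_coloring_def)
    \<comment> \<open>Splits the comparison of points into the three kinds of blocks.\<close>
    have coords: "(\<forall>i\<in>I. F ((u, x), a) i \<le> F ((v, y), b) i) \<and> (\<exists>i\<in>I. F ((u, x), a) i < F ((v, y), b) i)
      \<longleftrightarrow> (?fle \<and> ?\<psi>le \<and> ?hle) \<and> \<not> (?feq \<and> ?\<psi>eq \<and> ?heq)"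
    proof -
      have I: "(\<forall>i\<in>I. R i) \<longleftrightarrow> (\<forall>i<d1. R (Inl i))
        \<and> (\<forall>i<k. \<forall>j<d2. R (Inr (Inl (i, j)))) \<and> (\<forall>i<d3. R (Inr (Inr i)))" for R
        unfolding I_def Plus_def by blast
      have "(\<exists>i\<in>I. F ((u, x), a) i < F ((v, y), b) i)
          \<longleftrightarrow> \<not> (\<forall>i\<in>I. F ((u, x), a) i = F ((v, y), b) i)"
        if "\<forall>i\<in>I. F ((u, x), a) i \<le> F ((v, y), b) i"
        using that by (auto simp: order_less_le)
      moreover have "(\<forall>i\<in>I. F ((u, x), a) i \<le> F ((v, y), b) i) \<longleftrightarrow> ?fle \<and> ?\<psi>le \<and> ?hle"
        by (simp add: I F_def)
      moreover have "(\<forall>i\<in>I. F ((u, x), a) i = F ((v, y), b) i) \<longleftrightarrow> ?feq \<and> ?\<psi>eq \<and> ?heq"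
        by (simp add: I F_def)
      ultimately show ?thesis by blast
    qed
    have arc_iff: "(((u, x), a), ((v, y), b)) \<in> parcs ?Q \<longleftrightarrow>
      (a, b) \<in> parcs P \<and> ((u, v) \<in> parcs G \<or> u = v \<and> (x = y \<or> (x, y) \<in> parcs H))"
      using u x by (auto simp: ext_tensor_prod_def lexicographic_prod_def)
    \<comment> \<open>With equal colours both vertices store their \<open>g\<close> values in the
      same block, and \<open>arctan\<close> is monotone in both directions.\<close>
    have same_col: ?gle if "c u = c v" ?\<psi>le
    proof (intro allI impI)
      fix j assume "j < d2"
      then have "\<psi> ((u, x), a) (c u) j \<le> \<psi> ((v, y), b) (c u) j" using that(2) cu by blast
      then show "g (x, a) j \<le> g (y, b) j"
        using that(1) by (simp add: \<psi>_def arctan_le_iff)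
    qed
    show ?thesis unfolding coords
    proof
      assume A: "(((u, x), a), ((v, y), b)) \<in> parcs ?Q"
      then have ab: "(a, b) \<in> parcs P"
        and uv: "(u, v) \<in> parcs G \<or> u = v \<and> (x = y \<or> (x, y) \<in> parcs H)"
        by (simp_all add: arc_iff)
      have ne: "a \<noteq> b" using ab height_two_poset_no_path[OF P] by blast
      have "((u, a), (v, b)) \<in> parcs (ext_tensor_prod G P)"
        using u uv ab by (auto simp: ext_tensor_prod_def)
      \<comment> \<open>The \<open>f\<close> block already supplies strictness; the other blocks
        need only \<le>.\<close>
      then have 1: ?fle "\<not> ?feq"
        using realizes_iff[OF f, of "(u, a)" "(v, b)"] u a ne by (auto simp: ext_tensor_prod_def)
      have 2: ?hle using realizes_iff[OF h a ne] ab by simp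
      have "top b" "\<not> top a" using ab height_two_poset_no_path[OF P] by (auto simp: top_def)
      \<comment> \<open>Values of \<open>g\<close> meet only in a block of a common colour, which
        adjacency in \<open>G\<close> excludes. In every other block the lower side is -2 or the
        upper side is 2, since \<open>b\<close> is \<open>top\<close> and \<open>a\<close> is
        not.\<close>
      moreover have "?gle \<and> u = v \<or> c u \<noteq> c v"
      proof (cases "(u, v) \<in> parcs G")
        case True
        then show ?thesis using c by (simp add: proper_coloring_def)
      next
        case False
        then have "u = v" "((x, a), (y, b)) \<in> parcs (ext_tensor_prod H P)"
          using uv x ab by (auto simp: ext_tensor_prod_def)
        then show ?thesis
          using realizes_iff[OF g, of "(x, a)" "(y, b)"] x a ne by (auto simp: ext_tensor_prod_def)
      qed
      ultimately have ?\<psi>le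
        using bound by (auto simp: \<psi>_def arctan_le_iff less_imp_le)
      with 1 2 show "(?fle \<and> ?\<psi>le \<and> ?hle) \<and> \<not> (?feq \<and> ?\<psi>eq \<and> ?heq)" by blast
    next
      assume A: "(?fle \<and> ?\<psi>le \<and> ?hle) \<and> \<not> (?feq \<and> ?\<psi>eq \<and> ?heq)"
      have le: ?fle ?\<psi>le ?hle using A by blast+
      show "(((u, x), a), ((v, y), b)) \<in> parcs ?Q"
      proof (cases "(a, b) \<in> parcs P")
        case True
        then have uv: "u = v \<or> (u, v) \<in> parcs G"
          using ext_tensor_realizer_le_cases[OF P f u a le(1)] by blast
        have "x = y \<or> (x, y) \<in> parcs H" if "u = v"
          using ext_tensor_realizer_le_cases[OF P g x a same_col] that le(2) True by blast
        then show ?thesis using uv True by (auto simp: arc_iff)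
      next
        case False
        have feq: ?feq using ext_tensor_realizer_le_cases[OF P f u a le(1)] False by blast
        have heq: ?heq using realizes_iff[OF h a] le(3) False by (cases "a = b") auto
        \<comment> \<open>This is the purpose of the \<open>h\<close> block: it forces
          \<open>a\<close> and \<open>b\<close> to have the same predecessors, so both vertices use
          the same constant in foreign blocks.\<close>
        have top: "top a \<longleftrightarrow> top b"
          using realizer_twins[OF poset h a heq] by (simp add: top_def)
        have ?\<psi>eq
        proof (cases "c u = c v")
          case True
          then have ?geq
            using ext_tensor_realizer_le_cases[OF P g x a same_col] le(2) False by blast
          then show ?thesis using True top by (auto simp: \<psi>_def)
        next
          case ne: False
          \<comment> \<open>Block \<open>c u\<close> would force the common constant to be 2, and
            block \<open>c v\<close> would force it to be -2; so for different colours these blocks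
            must be empty.\<close>
          have "d2 = 0"
          proof (rule ccontr)
            assume "d2 \<noteq> 0"
            then have "\<psi> ((u, x), a) (c u) 0 \<le> \<psi> ((v, y), b) (c u) 0"
              "\<psi> ((u, x), a) (c v) 0 \<le> \<psi> ((v, y), b) (c v) 0"
              using le(2) cu by blast+
            then show False
              using ne top bound[of "g (x, a) 0"] bound[of "g (y, b) 0"]
              by (auto simp: \<psi>_def split: if_splits)
          qed
          then show ?thesis by simp
        qed
        with A feq heq show ?thesis by blast
      qed
    qed
  qed
  have "poset_dim ?Q \<le> card I"
  proof (rule poset_dim_le_card)
    show "finite I" by (simp add: I_def)
    fix p q assume "p \<in> pverts ?Q" "q \<in> pverts ?Q" "p \<noteq> q"
    moreover obtain u x a v y b where pq: "p = ((u, x), a)" "q = ((v, y), b)"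
      by (metis surj_pair)
    ultimately have "u \<in> pverts G" "v \<in> pverts G" "x \<in> pverts H" "y \<in> pverts H"
      "a \<in> pverts P" "b \<in> pverts P" "((u, x), a) \<noteq> ((v, y), b)"
      by (simp_all add: ext_tensor_prod_def lexicographic_prod_def)
    from arc[OF this] show "(p, q) \<in> parcs ?Q \<longleftrightarrow> (\<forall>i\<in>I. F p i \<le> F q i) \<and> (\<exists>i\<in>I. F p i < F q i)"
      unfolding pq .
  qed
  also have "card I = d1 + k * d2 + d3" by (simp add: I_def card_Plus)
  finally show ?thesis by (simp add: d)
qed

theorem theorem1p1:
  fixes G :: "'a pair_pre_digraph" and H :: "'b pair_pre_digraph"
    and J :: "'c pair_pre_digraph" and P :: "'d pair_pre_digraph"
  assumes "pair_graph G" and "pair_graph H" and "pair_graph J" and "height_two_poset P"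
  shows "im (tensor_prod (disj_prod G H) J) \<le> im (tensor_prod G J) + im (tensor_prod H J)
    \<and> sim (tensor_prod (disj_prod G H) J) \<le> sim (tensor_prod G J) + sim (tensor_prod H J)
    \<and> poset_dim (ext_tensor_prod (lexicographic_prod G H) P)
        \<le> poset_dim (ext_tensor_prod G P)
          + chromatic_number G * poset_dim (ext_tensor_prod H P) + poset_dim P"
  using im_tensor_disj_prod_le[OF assms(1-3)] sim_tensor_disj_prod_le[OF assms(1-3)]
    poset_dim_ext_tensor_lexicographic_prod_le[OF assms(1,2,4)] by blast

end
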